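(* Let $t\in[n]$ and let $S\subseteq N$ be a maximal $t$-switchable set. Then $P^{\langle t\rangle}_S$ is a minimal associated prime ideal of $\mathcal{I}^{\langle t\rangle}$.
   Context: Fix positive integers $n, r_1,\dots,r_n$, let $N=[r_1]\times\cdots\times[r_n]$, and let $R$ be the polynomial ring over a field in the variables $x_a$, $a\in N$. For $a,b\in N$ and $i\in[n]$, ${\rm s}(i,a,b)\in N$ has $i$-th component $b_i$ and other components equal to those of $a$. Let $d(a,b)=\#\{j: a_j\neq b_j\}$ and $f_{i,a,b}=x_ax_b-x_{{\rm s}(i,a,b)}x_{{\rm s}(i,b,a)}$. Let $\mathcal{I}^{\langle t\rangle}=(f_{i,a,b}: a,b\in N,\ d(a,b)=2,\ i\in[t])$. A subset $S\subseteq N$ is $t$-switchable if for all $a,b\in S$ with $d(a,b)=2$ and all $i\in[t]$, ${\rm s}(i,a,b)\in S$. Elements $a,b\in S$ are connected in $S$ if there are $a_0=a,\dots,a_k=b$ in $S$ with $d(a_{j-1},a_j)\le 1$ for all $j$. For $t$-switchable $S$: $\tilde{\mathcal{I}}^{\langle t\rangle}_S=(f_{i,a,b}: i\in[t],\ a,b \text{ connected in } S)$, $\mathrm{Var}^{\langle t\rangle}_S=(x_a: a\notin S)$, $P^{\langle t\rangle}_S=\mathrm{Var}^{\langle t\rangle}_S+\tilde{\mathcal{I}}^{\langle t\rangle}_S$. A $t$-switchable $S$ is maximal $t$-switchable if for every $t$-switchable $T$ properly containing $S$, $P^{\langle t\rangle}_S$ and $P^{\langle t\rangle}_T$ are incomparable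 under inclusion. *)

theory Defs
  imports "HOL-Library.Poly_Mapping"
begin

type_synonym point = "nat \<Rightarrow> nat"
type_synonym 'k mpoly = "(point \<Rightarrow>\<^sub>0 nat) \<Rightarrow>\<^sub>0 'k"

definition grid :: "nat \<Rightarrow> (nat \<Rightarrow> nat) \<Rightarrow> point set" where
  "grid n r = {a. (\<forall>j\<in>{1..n}. a j \<in> {1..r j}) \<and> (\<forall>j. j \<notin> {1..n} \<longrightarrow> a j = 0)}"

definition sw :: "nat \<Rightarrow> point \<Rightarrow> point \<Rightarrow> point" where
  "sw i a b = a(i := b i)"

definition dist_pt :: "nat \<Rightarrow> point \<Rightarrow> point \<Rightarrow> nat" where
  "dist_pt n a b = card {j\<in>{1..n}. a j \<noteq> b j}"

text \<open>The polynomial ring R = k[x_a : a in N], as a subring of polynomials in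
  variables indexed by all points.\<close>
definition polyring :: "point set \<Rightarrow> ('k::field) mpoly set" where
  "polyring V = {p. \<forall>m\<in>Poly_Mapping.keys p. Poly_Mapping.keys m \<subseteq> V}"

definition var :: "point \<Rightarrow> ('k::field) mpoly" where
  "var a = Poly_Mapping.single (Poly_Mapping.single a 1) 1"

definition fgen :: "nat \<Rightarrow> point \<Rightarrow> point \<Rightarrow> ('k::field) mpoly" where
  "fgen i a b = var a * var b - var (sw i a b) * var (sw i b a)"

definition ideal_in :: "'r::comm_ring_1 set \<Rightarrow> 'r set \<Rightarrow> bool" where
  "ideal_in R I \<longleftrightarrow> I \<subseteq> R \<and> 0 \<in> I \<and> (\<forall>x\<in>I. \<forall>y\<in>I. x + y \<in> I)
     \<and> (\<forall>r\<in>R. \<forall>x\<in>I. r * x \<in> I)"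

definition gen_ideal :: "'r::comm_ring_1 set \<Rightarrow> 'r set \<Rightarrow> 'r set" where
  "gen_ideal R G = \<Inter>{I. ideal_in R I \<and> G \<subseteq> I}"

definition ideal_sum :: "'r::comm_ring_1 set \<Rightarrow> 'r set \<Rightarrow> 'r set" where
  "ideal_sum I J = {x + y | x y. x \<in> I \<and> y \<in> J}"

definition prime_in :: "'r::comm_ring_1 set \<Rightarrow> 'r set \<Rightarrow> bool" where
  "prime_in R P \<longleftrightarrow> ideal_in R P \<and> P \<noteq> R \<and>
     (\<forall>a\<in>R. \<forall>b\<in>R. a * b \<in> P \<longrightarrow> a \<in> P \<or> b \<in> P)"

definition assoc_prime :: "'r::comm_ring_1 set \<Rightarrow> 'r set \<Rightarrow> 'r set \<Rightarrow> bool" where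
  "assoc_prime R I P \<longleftrightarrow> prime_in R P \<and> (\<exists>f\<in>R. P = {g\<in>R. g * f \<in> I})"

definition min_assoc_prime :: "'r::comm_ring_1 set \<Rightarrow> 'r set \<Rightarrow> 'r set \<Rightarrow> bool" where
  "min_assoc_prime R I P \<longleftrightarrow> assoc_prime R I P \<and>
     (\<forall>Q. assoc_prime R I Q \<and> Q \<subseteq> P \<longrightarrow> Q = P)"

definition Igen :: "nat \<Rightarrow> (nat \<Rightarrow> nat) \<Rightarrow> nat \<Rightarrow> ('k::field) mpoly set" where
  "Igen n r t = gen_ideal (polyring (grid n r))
     {fgen i a b | i a b. a \<in> grid n r \<and> b \<in> grid n r \<and> dist_pt n a b = 2 \<and> i \<in> {1..t}}"

definition switchable :: "nat \<Rightarrow> (nat \<Rightarrow> nat) \<Rightarrow> nat \<Rightarrow> point set \<Rightarrow> bool" where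
  "switchable n r t S \<longleftrightarrow> S \<subseteq> grid n r \<and>
     (\<forall>a\<in>S. \<forall>b\<in>S. dist_pt n a b = 2 \<longrightarrow> (\<forall>i\<in>{1..t}. sw i a b \<in> S))"

definition connected_in :: "nat \<Rightarrow> point set \<Rightarrow> point \<Rightarrow> point \<Rightarrow> bool" where
  "connected_in n S a b \<longleftrightarrow> a \<in> S \<and> b \<in> S \<and>
     (\<lambda>x y. x \<in> S \<and> y \<in> S \<and> dist_pt n x y \<le> 1)\<^sup>*\<^sup>* a b"

definition Itilde :: "nat \<Rightarrow> (nat \<Rightarrow> nat) \<Rightarrow> nat \<Rightarrow> point set \<Rightarrow> ('k::field) mpoly set" where
  "Itilde n r t S = gen_ideal (polyring (grid n r))
     {fgen i a b | i a b. i \<in> {1..t} \<and> connected_in n S a b}"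

definition VarS :: "nat \<Rightarrow> (nat \<Rightarrow> nat) \<Rightarrow> point set \<Rightarrow> ('k::field) mpoly set" where
  "VarS n r S = gen_ideal (polyring (grid n r)) {var a | a. a \<in> grid n r \<and> a \<notin> S}"

definition PS :: "nat \<Rightarrow> (nat \<Rightarrow> nat) \<Rightarrow> nat \<Rightarrow> point set \<Rightarrow> ('k::field) mpoly set" where
  "PS n r t S = ideal_sum (VarS n r S) (Itilde n r t S)"

definition max_switchable :: "'k::field itself \<Rightarrow> nat \<Rightarrow> (nat \<Rightarrow> nat) \<Rightarrow> nat \<Rightarrow> point set \<Rightarrow> bool" where
  "max_switchable _ n r t S \<longleftrightarrow> switchable n r t S \<and>
     (\<forall>T. switchable n r t T \<and> S \<subset> T \<longrightarrow>
        \<not> ((PS n r t S :: 'k mpoly set) \<subseteq> PS n r t T) \<and> \<not> ((PS n r t T :: 'k mpoly set) \<subseteq> PS n r t S))"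

end

theory Submission
  imports Defs
begin

text \<open>
  A minimal prime \<open>P\<close> of an ideal \<open>I\<close> that is finitely generated is associated: locally at \<open>P\<close> every
  generator of \<open>P\<close> is nilpotent modulo \<open>I\<close>. So it suffices to show that \<open>P\<^sub>S\<close> is a minimal prime.

  If \<open>Q \<subseteq> P\<^sub>S\<close> is a prime containing the ideal, then the set \<open>T\<close> of all \<open>a\<close> with \<open>x\<^sub>a \<notin> Q\<close> is switchable and
  contains \<open>S\<close>. The generators \<open>f\<^sub>i\<^sub>,\<^sub>a\<^sub>,\<^sub>b\<close> of \<open>P\<^sub>T\<close> for connected \<open>a\<close>, \<open>b\<close> are obtained from those at
  distance two along a path, cancelling variables of \<open>T\<close>; hence \<open>P\<^sub>T \<subseteq> Q \<subseteq> P\<^sub>S\<close>, and maximality gives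
  \<open>T = S\<close> and \<open>Q = P\<^sub>S\<close>.

  Primality is toric. A component of \<open>S\<close> is closed under switching any of the first \<open>t\<close> coordinates, so it
  is a product of \<open>t\<close> sets of coordinates with a set of tails, and the Segre-type map sending \<open>x\<^sub>a\<close> to
  the product of one variable for each of its first \<open>t\<close> coordinates and one for its tail (all indexed
  by the component), and \<open>x\<^sub>a\<close> to \<open>0\<close> for \<open>a \<notin> S\<close>, has kernel \<open>P\<^sub>S\<close>: two monomials with the same image
  are related by switches.
\<close>

section \<open>Minimal primes of finite type are associated\<close>

text \<open>Ideals here live in a subset \<open>R\<close> of a larger ring type, as
  \<open>polyring\<close> does among polynomials in all points, so the elementary ideal theory is
  set up relative to a carrier.\<close>

locale subring_carrier =
  fixes R :: "'r::comm_ring_1 set"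
  assumes one_closed: "1 \<in> R"
    and uminus_closed: "x \<in> R \<Longrightarrow> - x \<in> R"
    and add_closed: "x \<in> R \<Longrightarrow> y \<in> R \<Longrightarrow> x + y \<in> R"
    and mult_closed: "x \<in> R \<Longrightarrow> y \<in> R \<Longrightarrow> x * y \<in> R"
begin

lemma zero_closed: "0 \<in> R"
  using add_closed[OF one_closed uminus_closed[OF one_closed]] by simp

lemma power_closed: "x \<in> R \<Longrightarrow> x ^ k \<in> R"
  by (induction k) (auto intro: one_closed mult_closed)

lemma ideal_in_carrier: "ideal_in R R"
  by (auto simp: ideal_in_def intro: zero_closed add_closed mult_closed)

lemma ideal_in_gen_ideal:
  assumes "G \<subseteq> R"
  shows "ideal_in R (gen_ideal R G)"
proof -
  have "gen_ideal R G \<subseteq> R"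
    unfolding gen_ideal_def using assms ideal_in_carrier by blast
  then show ?thesis
    by (auto simp: gen_ideal_def ideal_in_def)
qed

lemma gen_ideal_superset: "G \<subseteq> gen_ideal R G"
  by (auto simp: gen_ideal_def)

lemma gen_ideal_least: "ideal_in R I \<Longrightarrow> G \<subseteq> I \<Longrightarrow> gen_ideal R G \<subseteq> I"
  by (auto simp: gen_ideal_def)

lemma ideal_in_ideal_sum:
  assumes I: "ideal_in R I" and J: "ideal_in R J"
  shows "ideal_in R (ideal_sum I J)"
  unfolding ideal_in_def
proof (intro conjI ballI)
  show "ideal_sum I J \<subseteq> R"
    using I J add_closed by (auto simp: ideal_sum_def ideal_in_def)
  have "0 + 0 \<in> ideal_sum I J"
    using I J unfolding ideal_sum_def ideal_in_def by blast
  then show "0 \<in> ideal_sum I J"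
    by simp
next
  fix x y assume "x \<in> ideal_sum I J" "y \<in> ideal_sum I J"
  then obtain i j i' j' where *: "x = i + j" "y = i' + j'" "i \<in> I" "j \<in> J" "i' \<in> I" "j' \<in> J"
    by (auto simp: ideal_sum_def)
  then have "x + y = (i + i') + (j + j')" "i + i' \<in> I" "j + j' \<in> J"
    using I J by (auto simp: ideal_in_def)
  then show "x + y \<in> ideal_sum I J"
    unfolding ideal_sum_def by blast
next
  fix r x assume "r \<in> R" "x \<in> ideal_sum I J"
  then obtain i j where *: "x = i + j" "i \<in> I" "j \<in> J"
    by (auto simp: ideal_sum_def)
  then have "r * x = r * i + r * j" "r * i \<in> I" "r * j \<in> J"
    using I J \<open>r \<in> R\<close> by (auto simp: ideal_in_def distrib_left)
  then show "r * x \<in> ideal_sum I J"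
    unfolding ideal_sum_def by blast
qed

lemma ideal_add: "ideal_in R I \<Longrightarrow> x \<in> I \<Longrightarrow> y \<in> I \<Longrightarrow> x + y \<in> I"
  by (simp add: ideal_in_def)

lemma ideal_uminus:
  assumes "ideal_in R I" "x \<in> I"
  shows "- x \<in> I"
proof -
  have "(- 1) * x \<in> I"
    using assms uminus_closed[OF one_closed] unfolding ideal_in_def by blast
  then show ?thesis
    by simp
qed

lemma ideal_diff:
  assumes "ideal_in R I" "x \<in> I" "y \<in> I"
  shows "x - y \<in> I"
proof -
  have "x + (- y) \<in> I"
    using assms ideal_uminus unfolding ideal_in_def by blast
  then show ?thesis
    by simp
qed

lemma ideal_sum_elements:
  assumes "ideal_in R I" "\<And>a. a \<in> A \<Longrightarrow> f a \<in> I"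
  shows "sum f A \<in> I"
  using assms by (induction A rule: infinite_finite_induct) (auto simp: ideal_in_def)

section \<open>Existence of primes and local nilpotency at a minimal prime\<close>

lemma one_notin_prime:
  assumes "prime_in R P"
  shows "1 \<notin> P"
proof
  assume "1 \<in> P"
  then have "r * 1 \<in> P" if "r \<in> R" for r
    using assms that unfolding prime_in_def ideal_in_def by blast
  then show False
    using assms by (auto simp: prime_in_def ideal_in_def)
qed

text \<open>Krull's argument: Zorn gives an ideal \<open>Q\<close> maximal among those that contain
  \<open>I\<close> and miss \<open>M\<close>. If \<open>a\<close> and \<open>b\<close> are outside
  \<open>Q\<close>, then Q + Ra and Q + Rb both meet \<open>M\<close>; with \<open>a * b\<close> in
  \<open>Q\<close>, the product of the two common elements would lie in \<open>Q\<close> and in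
  \<open>M\<close>.\<close>

lemma ex_prime_avoiding:
  assumes I: "ideal_in R I" and M: "M \<subseteq> R" "1 \<in> M"
    and mult: "\<And>x y. x \<in> M \<Longrightarrow> y \<in> M \<Longrightarrow> x * y \<in> M" and disj: "I \<inter> M = {}"
  obtains Q where "prime_in R Q" "I \<subseteq> Q" "Q \<inter> M = {}"
proof -
  let ?A = "{J. ideal_in R J \<and> I \<subseteq> J \<and> J \<inter> M = {}}"
  have "\<exists>Q\<in>?A. \<forall>X\<in>?A. Q \<subseteq> X \<longrightarrow> X = Q"
  proof (rule subset_Zorn_nonempty)
    show "?A \<noteq> {}"
      using I disj by blast
    fix C assume C: "C \<noteq> {}" "subset.chain ?A C"
    then have sub: "J \<in> ?A" if "J \<in> C" for J
      using that by (auto simp: subset.chain_def)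
    have chain: "J \<subseteq> K \<or> K \<subseteq> J" if "J \<in> C" "K \<in> C" for J K
      using C(2) that by (auto simp: subset_chain_def)
    have "ideal_in R (\<Union>C)"
      unfolding ideal_in_def
    proof (intro conjI ballI)
      show "\<Union>C \<subseteq> R"
        using sub unfolding ideal_in_def by blast
      obtain J where "J \<in> C"
        using C(1) by blast
      then show "0 \<in> \<Union>C"
        using sub[of J] by (auto simp: ideal_in_def)
    next
      fix x y assume "x \<in> \<Union>C" "y \<in> \<Union>C"
      then obtain J K where JK: "x \<in> J" "J \<in> C" "y \<in> K" "K \<in> C"
        by blast
      then obtain L where "x \<in> L" "y \<in> L" "L \<in> C"
        using chain[of J K] by blast
      then show "x + y \<in> \<Union>C"
        using sub[of L] unfolding ideal_in_def by blast
    next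
      fix r x assume "r \<in> R" "x \<in> \<Union>C"
      then obtain J where "x \<in> J" "J \<in> C"
        by blast
      then show "r * x \<in> \<Union>C"
        using sub[of J] \<open>r \<in> R\<close> unfolding ideal_in_def by blast
    qed
    moreover have "I \<subseteq> J \<and> J \<inter> M = {}" if "J \<in> C" for J
      using sub[OF that] by simp
    then have "I \<subseteq> \<Union>C" "\<Union>C \<inter> M = {}"
      using C(1) by blast+
    ultimately show "\<Union>C \<in> ?A"
      by blast
  qed
  then obtain Q where Q: "ideal_in R Q" "I \<subseteq> Q" "Q \<inter> M = {}"
    and max: "\<And>X. ideal_in R X \<Longrightarrow> I \<subseteq> X \<Longrightarrow> X \<inter> M = {} \<Longrightarrow> Q \<subseteq> X \<Longrightarrow> X = Q"
    by auto
  \<comment> \<open>Otherwise Q + Ra would be a strictly larger ideal missing \<open>M\<close>,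
    against the maximality of \<open>Q\<close>.\<close>
  have meets: "\<exists>q\<in>Q. \<exists>r\<in>R. q + r * a \<in> M" if a: "a \<in> R" "a \<notin> Q" for a
  proof (rule ccontr)
    assume *: "\<not> ?thesis"
    let ?X = "ideal_sum Q {r * a | r. r \<in> R}"
    have "ideal_in R {r * a | r. r \<in> R}"
      unfolding ideal_in_def
    proof (intro conjI ballI)
      show "{r * a | r. r \<in> R} \<subseteq> R"
        using a mult_closed by auto
      show "0 \<in> {r * a | r. r \<in> R}"
        using zero_closed by force
      show "x + y \<in> {r * a | r. r \<in> R}" if xy: "x \<in> {r * a | r. r \<in> R}" "y \<in> {r * a | r. r \<in> R}" for x y
      proof -
        obtain r r' where "x = r * a" "y = r' * a" "r \<in> R" "r' \<in> R"
          using xy by blast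
        then have "x + y = (r + r') * a" "r + r' \<in> R"
          by (simp_all add: distrib_right add_closed)
        then show ?thesis
          by blast
      qed
      show "s * x \<in> {r * a | r. r \<in> R}" if sx: "s \<in> R" "x \<in> {r * a | r. r \<in> R}" for s x
      proof -
        obtain r where "x = r * a" "r \<in> R"
          using sx by blast
        then have "s * x = (s * r) * a" "s * r \<in> R"
          using sx by (simp_all add: mult.assoc mult_closed)
        then show ?thesis
          by blast
      qed
    qed
    then have X: "ideal_in R ?X"
      by (rule ideal_in_ideal_sum[OF Q(1)])
    have QX: "Q \<subseteq> ?X"
    proof
      fix q assume "q \<in> Q"
      moreover have "q = q + 0 * a"
        by simp
      ultimately show "q \<in> ?X"
        unfolding ideal_sum_def using zero_closed by blast
    qed
    have "a \<in> ?X"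
    proof -
      have "a = 0 + 1 * a" "0 \<in> Q"
        using Q(1) by (auto simp: ideal_in_def)
      then show ?thesis
        unfolding ideal_sum_def using one_closed by blast
    qed
    moreover have "?X \<inter> M = {}"
      using * unfolding ideal_sum_def by blast
    then have "?X = Q"
      using max[OF X _ _ QX] QX Q(2) by (meson order_trans)
    ultimately show False
      using a(2) by simp
  qed
  have "a \<in> Q \<or> b \<in> Q" if ab: "a \<in> R" "b \<in> R" "a * b \<in> Q" for a b
  proof (rule ccontr)
    assume "\<not> ?thesis"
    then obtain q r q' r' where m: "q \<in> Q" "r \<in> R" "q + r * a \<in> M" "q' \<in> Q" "r' \<in> R" "q' + r' * b \<in> M"
      using meets[of a] meets[of b] ab by blast
    have "(q + r * a) * (q' + r' * b) = (q' + r' * b) * q + (r * a) * q' + (r * r') * (a * b)"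
      by (simp add: algebra_simps)
    also have "\<dots> \<in> Q"
    proof -
      have "q' + r' * b \<in> R" "r * a \<in> R" "r * r' \<in> R"
        using m ab M(1) mult_closed by auto
      then show ?thesis
        using Q(1) m(1,4) ab(3) unfolding ideal_in_def by simp
    qed
    finally show False
      using mult[OF m(3,6)] Q(3) by blast
  qed
  moreover have "Q \<noteq> R"
    using Q(3) M by auto
  ultimately have "prime_in R Q"
    using Q(1) by (auto simp: prime_in_def)
  then show ?thesis
    using Q(2,3) by (rule that)
qed

text \<open>If no such \<open>s\<close> and \<open>k\<close> exist, the products
  \<open>s * g ^ k\<close> with \<open>s\<close> outside \<open>P\<close> form a multiplicative set
  disjoint from \<open>I\<close>. A prime over \<open>I\<close> avoiding it lies in \<open>P\<close>
  (take \<open>k = 0\<close>), hence equals \<open>P\<close> by minimality, yet it misses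
  \<open>g\<close> (take \<open>s = 1\<close>, \<open>k = 1\<close>).\<close>

lemma minimal_prime_locally_nilpotent:
  assumes I: "ideal_in R I" and P: "prime_in R P"
    and min: "\<And>Q. prime_in R Q \<Longrightarrow> I \<subseteq> Q \<Longrightarrow> Q \<subseteq> P \<Longrightarrow> Q = P"
    and g: "g \<in> P"
  obtains s k where "s \<in> R" "s \<notin> P" "s * g ^ k \<in> I"
proof (rule ccontr)
  assume "\<not> thesis"
  then have *: "s \<in> R \<Longrightarrow> s \<notin> P \<Longrightarrow> s * g ^ k \<in> I \<Longrightarrow> False" for s k
    using that by blast
  have no: "s * g ^ k \<notin> I" if "s \<in> R" "s \<notin> P" for s k
    using *[OF that] by blast
  have gR: "g \<in> R"
    using g P by (auto simp: prime_in_def ideal_in_def)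
  let ?M = "{s * g ^ k | s k. s \<in> R \<and> s \<notin> P}"
  have "?M \<subseteq> R"
    using gR by (auto intro: mult_closed power_closed)
  moreover have in_M: "s * g ^ k \<in> ?M" if "s \<in> R" "s \<notin> P" for s k
    using that by blast
  then have "1 \<in> ?M"
    using in_M[of 1 0] one_notin_prime[OF P] one_closed by simp
  moreover have "x * y \<in> ?M" if xy: "x \<in> ?M" "y \<in> ?M" for x y
  proof -
    obtain s k s' k' where "x = s * g ^ k" "y = s' * g ^ k'" "s \<in> R" "s \<notin> P" "s' \<in> R" "s' \<notin> P"
      using xy by blast
    moreover from this have "x * y = (s * s') * g ^ (k + k')"
      by (simp add: power_add algebra_simps)
    moreover from calculation have "s * s' \<in> R" "s * s' \<notin> P"
      using P mult_closed by (auto simp: prime_in_def)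
    ultimately show ?thesis
      by blast
  qed
  moreover have "I \<inter> ?M = {}"
    using no by auto
  ultimately obtain Q where Q: "prime_in R Q" "I \<subseteq> Q" "Q \<inter> ?M = {}"
    using ex_prime_avoiding[OF I, of ?M] by blast
  have "Q \<subseteq> P"
  proof
    fix q assume q: "q \<in> Q"
    then have "q \<in> R"
      using Q(1) by (auto simp: prime_in_def ideal_in_def)
    then show "q \<in> P"
      using in_M[of q 0] Q(3) q by auto
  qed
  then have "g \<in> Q"
    using min Q(1,2) g by blast
  then show False
    using in_M[of 1 1] one_notin_prime[OF P] one_closed Q(3) by auto
qed

text \<open>The witness \<open>f\<close> with \<open>P = (I : f)\<close> is built one generator \<open>g\<close> of \<open>P\<close> at a time: with \<open>k\<close>
  minimal such that \<open>s g\<^sup>k f \<in> I\<close> for some \<open>s \<notin> P\<close>, replace \<open>f\<close> by \<open>s g\<^sup>k\<^sup>-\<^sup>1 f\<close>.\<close>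

lemma assoc_prime_of_minimal_prime:
  assumes I: "ideal_in R I" and P: "prime_in R P" and IP: "I \<subseteq> P"
    and G: "finite G" "G \<subseteq> P" "\<And>J. ideal_in R J \<Longrightarrow> G \<subseteq> J \<Longrightarrow> P \<subseteq> J"
    and min: "\<And>Q. prime_in R Q \<Longrightarrow> I \<subseteq> Q \<Longrightarrow> Q \<subseteq> P \<Longrightarrow> Q = P"
  shows "assoc_prime R I P"
proof -
  have PR: "P \<subseteq> R"
    using P by (auto simp: prime_in_def ideal_in_def)
  \<comment> \<open>Invariant of the induction on generators: the colon ideal (I : f) stays inside
    \<open>P\<close> while it absorbs one generator after another.\<close>
  have "\<exists>f\<in>R. (\<forall>h\<in>R. h * f \<in> I \<longrightarrow> h \<in> P) \<and> (\<forall>g\<in>G. g * f \<in> I)"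
    using G(1,2)
  proof (induction G rule: finite_induct)
    case empty
    then show ?case
      using IP one_closed by (intro bexI[of _ 1]) auto
  next
    case (insert g G)
    then obtain f where f: "f \<in> R" "\<And>h. h \<in> R \<Longrightarrow> h * f \<in> I \<Longrightarrow> h \<in> P" "\<And>g. g \<in> G \<Longrightarrow> g * f \<in> I"
      by auto
    let ?K = "\<lambda>k. \<exists>s\<in>R. s \<notin> P \<and> s * g ^ k * f \<in> I"
    obtain s k where "s \<in> R" "s \<notin> P" "s * g ^ k \<in> I"
      using minimal_prime_locally_nilpotent[OF I P min] insert.prems by auto
    then have "?K k"
      using I f(1) by (metis ideal_in_def mult.commute)
    define k0 where "k0 = (LEAST k. ?K k)"
    have "?K k0"
      unfolding k0_def using \<open>?K k\<close> by (rule LeastI)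
    then obtain s where s: "s \<in> R" "s \<notin> P" "s * g ^ k0 * f \<in> I"
      by blast
    have least: "\<not> ?K j" if "j < k0" for j
      using that not_less_Least unfolding k0_def by blast
    \<comment> \<open>With \<open>k0 = 0\<close> the element \<open>s\<close>, which is outside
      \<open>P\<close>, would lie in (I : f), which is inside \<open>P\<close>.\<close>
    have "k0 \<noteq> 0"
      using s f(2)[of s] by (cases k0) auto
    then obtain j where j: "k0 = Suc j"
      using not0_implies_Suc by blast
    have gR: "g \<in> R"
      using insert.prems PR by auto
    define u where "u = s * g ^ j"
    have u: "u \<in> R"
      unfolding u_def using s(1) gR by (intro mult_closed power_closed)
    show ?case
    proof (intro bexI conjI ballI impI)
      show "u * f \<in> R"
        using u f(1) by (rule mult_closed)
      fix h assume h: "h \<in> R" "h * (u * f) \<in> I"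
      show "h \<in> P"
      proof (rule ccontr)
        assume "h \<notin> P"
        then have "h * s \<in> R" "h * s \<notin> P"
          using h s P mult_closed by (auto simp: prime_in_def)
        moreover have "h * s * g ^ j * f \<in> I"
          using h(2) by (simp add: u_def mult.assoc)
        ultimately show False
          using least[of j] j by blast
      qed
    next
      fix g' assume "g' \<in> insert g G"
      then consider "g' = g" | "g' \<in> G"
        by blast
      then show "g' * (u * f) \<in> I"
      proof cases
        case 1
        then have "g' * (u * f) = s * g ^ k0 * f"
          by (simp add: u_def j mult_ac)
        then show ?thesis
          using s(3) by simp
      next
        case 2
        then have "u * (g' * f) \<in> I"
          using f(3) u I by (auto simp: ideal_in_def)
        then show ?thesis
          by (simp add: mult.left_commute)
      qed
    qed
  qed
  then obtain f where f: "f \<in> R" "\<And>h. h \<in> R \<Longrightarrow> h * f \<in> I \<Longrightarrow> h \<in> P" "\<And>g. g \<in> G \<Longrightarrow> g * f \<in> I"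
    by auto
  have "ideal_in R {g \<in> R. g * f \<in> I}"
    using I zero_closed add_closed mult_closed
    by (auto simp: ideal_in_def distrib_right mult.assoc)
  moreover have "G \<subseteq> {g \<in> R. g * f \<in> I}"
    using G(2) PR f(3) by auto
  ultimately have "P \<subseteq> {g \<in> R. g * f \<in> I}"
    by (rule G(3))
  moreover have "{g \<in> R. g * f \<in> I} \<subseteq> P"
    using f(2) by auto
  ultimately show ?thesis
    unfolding assoc_prime_def using P f(1) by (intro conjI bexI[of _ f] subset_antisym)
qed

text \<open>Every associated prime (I : f) contains \<open>I\<close>, so minimality among the primes
  over \<open>I\<close> passes to the associated ones.\<close>

lemma min_assoc_prime_of_minimal_prime:
  assumes I: "ideal_in R I" and P: "prime_in R P" and IP: "I \<subseteq> P"
    and G: "finite G" "G \<subseteq> P" "\<And>J. ideal_in R J \<Longrightarrow> G \<subseteq> J \<Longrightarrow> P \<subseteq> J"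
    and min: "\<And>Q. prime_in R Q \<Longrightarrow> I \<subseteq> Q \<Longrightarrow> Q \<subseteq> P \<Longrightarrow> Q = P"
  shows "min_assoc_prime R I P"
  unfolding min_assoc_prime_def
proof (intro conjI allI impI)
  show "assoc_prime R I P"
    using assms by (rule assoc_prime_of_minimal_prime)
  fix Q assume Q: "assoc_prime R I Q \<and> Q \<subseteq> P"
  then obtain f where f: "f \<in> R" "Q = {g \<in> R. g * f \<in> I}" "prime_in R Q"
    unfolding assoc_prime_def by blast
  have "g \<in> R \<and> f * g \<in> I" if "g \<in> I" for g
    using I f(1) that by (auto simp: ideal_in_def)
  then have "I \<subseteq> Q"
    by (auto simp: f(2) mult.commute)
  then show "Q = P"
    using min[OF f(3)] Q by auto
qed

end

section \<open>Switchable sets\<close>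

lemma finite_grid: "finite (grid n r)"
proof (rule finite_subset)
  let ?M = "Max (r ` {1..n})"
  show "grid n r \<subseteq> {f. \<forall>j. (j \<in> {1..n} \<longrightarrow> f j \<in> {..?M}) \<and> (j \<notin> {1..n} \<longrightarrow> f j = 0)}"
  proof
    fix a assume a: "a \<in> grid n r"
    have "a j \<le> ?M" if "j \<in> {1..n}" for j
    proof -
      have "a j \<le> r j"
        using a that by (auto simp: grid_def)
      also have "\<dots> \<le> ?M"
        using that by (intro Max_ge) auto
      finally show ?thesis .
    qed
    then show "a \<in> {f. \<forall>j. (j \<in> {1..n} \<longrightarrow> f j \<in> {..?M}) \<and> (j \<notin> {1..n} \<longrightarrow> f j = 0)}"
      using a by (simp add: grid_def)
  qed
  show "finite {f. \<forall>j. (j \<in> {1..n} \<longrightarrow> f j \<in> {..?M}) \<and> (j \<notin> {1..n} \<longrightarrow> f j = 0)}"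
    by (rule finite_set_of_finite_funs) auto
qed

lemma sw_in_grid: "a \<in> grid n r \<Longrightarrow> b \<in> grid n r \<Longrightarrow> sw i a b \<in> grid n r"
  by (auto simp: grid_def sw_def)

text \<open>Replaces the cardinality by one exceptional coordinate. Points of the grid vanish
  outside \<open>{1..n}\<close>, so \<open>k\<close> may range over all naturals.\<close>

lemma dist_pt_le_1_iff:
  assumes "x \<in> grid n r" "y \<in> grid n r"
  shows "dist_pt n x y \<le> 1 \<longleftrightarrow> (\<exists>j. \<forall>k. k \<noteq> j \<longrightarrow> x k = y k)"
proof -
  have out: "x k = y k" if "k \<notin> {1..n}" for k
    using assms that by (auto simp: grid_def)
  have "dist_pt n x y \<le> 1 \<longleftrightarrow> (\<forall>i\<in>{j\<in>{1..n}. x j \<noteq> y j}. \<forall>k\<in>{j\<in>{1..n}. x j \<noteq> y j}. i = k)"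
    unfolding dist_pt_def One_nat_def by (rule card_le_Suc0_iff_eq) simp
  also have "\<dots> \<longleftrightarrow> (\<forall>i k. x i \<noteq> y i \<longrightarrow> x k \<noteq> y k \<longrightarrow> i = k)"
    using out by blast
  also have "\<dots> \<longleftrightarrow> (\<exists>j. \<forall>k. k \<noteq> j \<longrightarrow> x k = y k)"
    by metis
  finally show ?thesis .
qed

lemma dist_pt_eq_2I:
  assumes "x \<in> grid n r" "y \<in> grid n r" "i \<noteq> j" "x i \<noteq> y i" "x j \<noteq> y j"
    and "\<And>k. k \<noteq> i \<Longrightarrow> k \<noteq> j \<Longrightarrow> x k = y k"
  shows "dist_pt n x y = 2"
proof -
  have "k \<in> {1..n}" if "x k \<noteq> y k" for k
    using assms(1,2) that unfolding grid_def by force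
  then have "{k\<in>{1..n}. x k \<noteq> y k} = {i, j}"
    using assms by blast
  then show ?thesis
    using \<open>i \<noteq> j\<close> by (simp add: dist_pt_def)
qed

section \<open>Components of a switchable set\<close>

lemma dist_pt_commute: "dist_pt n a b = dist_pt n b a"
  unfolding dist_pt_def by metis

lemma connected_in_refl: "a \<in> S \<Longrightarrow> connected_in n S a a"
  by (simp add: connected_in_def)

lemma connected_in_trans: "connected_in n S a b \<Longrightarrow> connected_in n S b c \<Longrightarrow> connected_in n S a c"
  by (auto simp: connected_in_def)

lemma connected_in_sym:
  assumes "connected_in n S a b"
  shows "connected_in n S b a"
proof -
  let ?E = "\<lambda>x y. x \<in> S \<and> y \<in> S \<and> dist_pt n x y \<le> 1"
  have "symp ?E"
    by (auto simp: symp_def dist_pt_commute)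
  then have "symp ?E\<^sup>*\<^sup>*"
    by (rule symp_rtranclp)
  then show ?thesis
    using assms unfolding connected_in_def by (auto dest: sympD)
qed

lemma connected_in_step: "a \<in> S \<Longrightarrow> b \<in> S \<Longrightarrow> dist_pt n a b \<le> 1 \<Longrightarrow> connected_in n S a b"
  by (auto simp: connected_in_def)

lemma connected_in_sw:
  assumes "S \<subseteq> grid n r" "a \<in> S" "sw i a b \<in> S"
  shows "connected_in n S a (sw i a b)"
proof (rule connected_in_step)
  have "\<exists>j. \<forall>k. k \<noteq> j \<longrightarrow> a k = sw i a b k"
    by (auto simp: sw_def)
  then show "dist_pt n a (sw i a b) \<le> 1"
    using dist_pt_le_1_iff[of a n r "sw i a b"] assms by blast
qed (use assms in auto)

text \<open>Extends closure under switching from distance two to a whole component. The induction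
  extends the path at its start: if \<open>x\<close> and \<open>y\<close> differ only at
  \<open>j\<close>, then in general \<open>x\<close> and \<open>sw i y b\<close> differ exactly at
  \<open>i\<close> and \<open>j\<close>, and switching \<open>x\<close> with that point at
  \<open>i\<close> gives \<open>sw i x b\<close>.\<close>

lemma switchable_connected:
  assumes S: "switchable n r t S" and i: "i \<in> {1..t}" and ab: "connected_in n S a b"
  shows "sw i a b \<in> S"
proof -
  have sub: "S \<subseteq> grid n r"
    using S by (simp add: switchable_def)
  from ab have "(\<lambda>x y. x \<in> S \<and> y \<in> S \<and> dist_pt n x y \<le> 1)\<^sup>*\<^sup>* a b" and b: "b \<in> S"
    by (auto simp: connected_in_def)
  then show ?thesis
  proof (induction rule: converse_rtranclp_induct)
    case base
    then show ?case
      by (simp add: sw_def)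
  next
    case (step x y)
    then have xy: "x \<in> S" "y \<in> S" and c: "sw i y b \<in> S"
      by auto
    obtain j where j: "\<And>k. k \<noteq> j \<Longrightarrow> x k = y k"
      using step.hyps(1) dist_pt_le_1_iff[of x n r y] sub by blast
    then have eq: "x = y" if "x j = y j"
      using that by (metis ext)
    \<comment> \<open>In the degenerate cases below, \<open>sw i x b\<close> is already
      \<open>sw i y b\<close> or \<open>x\<close>.\<close>
    show ?case
    proof (cases "j = i \<or> b i = x i \<or> x j = y j")
      case True
      then have "sw i x b = sw i y b \<or> sw i x b = x"
        using j eq by (auto simp: sw_def fun_eq_iff)
      then show ?thesis
        using c xy by auto
    next
      case False
      have "dist_pt n x (sw i y b) = 2"
        by (rule dist_pt_eq_2I[where i=i and j=j and r=r])
          (use False xy c sub j in \<open>auto simp: sw_def\<close>)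
      then have "sw i x (sw i y b) \<in> S"
        using S xy(1) c i by (auto simp: switchable_def)
      moreover have "sw i x (sw i y b) = sw i x b"
        by (simp add: sw_def)
      ultimately show ?thesis
        by simp
    qed
  qed
qed

lemma switchable_connected_sw:
  assumes "switchable n r t S" "i \<in> {1..t}" "connected_in n S a b"
  shows "connected_in n S a (sw i a b)"
  using assms switchable_connected[OF assms] connected_in_sw[of S n r a i b]
  by (auto simp: switchable_def connected_in_def)

section \<open>The ideals \<open>P\<^sub>S\<close>\<close>

text \<open>Natural exponents cannot cancel, which makes this an equality and not just an
  inclusion.\<close>

lemma keys_plus_nat:
  fixes m m' :: "'a \<Rightarrow>\<^sub>0 nat"
  shows "Poly_Mapping.keys (m + m') = Poly_Mapping.keys m \<union> Poly_Mapping.keys m'"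
  by (auto simp: in_keys_iff lookup_add)

lemma subring_carrier_polyring: "subring_carrier (polyring V :: 'k::field mpoly set)"
proof
  show "x + y \<in> polyring V" if "x \<in> polyring V" "y \<in> polyring V" for x y :: "'k mpoly"
    using that keys_add[of x y] unfolding polyring_def by blast
  show "x * y \<in> polyring V" if "x \<in> polyring V" "y \<in> polyring V" for x y :: "'k mpoly"
  proof -
    have "Poly_Mapping.keys m \<subseteq> V" if m: "m \<in> Poly_Mapping.keys (x * y)" for m
    proof -
      obtain a b where "m = a + b" "a \<in> Poly_Mapping.keys x" "b \<in> Poly_Mapping.keys y"
        using m keys_mult[of x y] by blast
      then show ?thesis
        using \<open>x \<in> polyring V\<close> \<open>y \<in> polyring V\<close> by (auto simp: polyring_def keys_plus_nat)
    qed
    then show ?thesis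
      by (simp add: polyring_def)
  qed
qed (auto simp: polyring_def)

lemma single_in_polyring: "Poly_Mapping.keys m \<subseteq> V \<Longrightarrow> Poly_Mapping.single m c \<in> polyring V"
  by (simp add: polyring_def)

lemma var_in_polyring: "a \<in> V \<Longrightarrow> var a \<in> polyring V"
  unfolding var_def by (rule single_in_polyring) simp

lemma fgen_in_polyring:
  assumes "a \<in> grid n r" "b \<in> grid n r"
  shows "fgen i a b \<in> polyring (grid n r)"
proof -
  interpret subring_carrier "polyring (grid n r)"
    by (rule subring_carrier_polyring)
  have "var a * var b + - (var (sw i a b) * var (sw i b a)) \<in> polyring (grid n r)"
    using assms by (intro add_closed uminus_closed mult_closed var_in_polyring sw_in_grid)
  then show ?thesis
    by (simp add: fgen_def)
qed

section \<open>Generators of \<open>PS\<close> and its position relative to \<open>Igen\<close> and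
  the primes above it\<close>

context
  fixes n t :: nat and r :: "nat \<Rightarrow> nat"
begin

interpretation subring_carrier "polyring (grid n r) :: 'k::field mpoly set"
  by (rule subring_carrier_polyring)

lemma ideal_in_Igen: "ideal_in (polyring (grid n r)) (Igen n r t :: 'k::field mpoly set)"
  unfolding Igen_def by (rule ideal_in_gen_ideal) (auto intro: fgen_in_polyring)

lemma fgen_in_Igen:
  "a \<in> grid n r \<Longrightarrow> b \<in> grid n r \<Longrightarrow> dist_pt n a b = 2 \<Longrightarrow> i \<in> {1..t} \<Longrightarrow>
    (fgen i a b :: 'k::field mpoly) \<in> Igen n r t"
  unfolding Igen_def by (rule subsetD[OF gen_ideal_superset]) blast

lemma Igen_least:
  assumes "ideal_in (polyring (grid n r)) (J :: 'k::field mpoly set)"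
    and "\<And>i a b. a \<in> grid n r \<Longrightarrow> b \<in> grid n r \<Longrightarrow> dist_pt n a b = 2 \<Longrightarrow> i \<in> {1..t} \<Longrightarrow> fgen i a b \<in> J"
  shows "Igen n r t \<subseteq> J"
  unfolding Igen_def by (rule gen_ideal_least) (use assms in auto)

context
  fixes S :: "point set"
  assumes S_grid: "S \<subseteq> grid n r"
begin

lemma ideal_in_VarS: "ideal_in (polyring (grid n r)) (VarS n r S :: 'k::field mpoly set)"
  unfolding VarS_def by (rule ideal_in_gen_ideal) (auto intro: var_in_polyring)

lemma ideal_in_Itilde: "ideal_in (polyring (grid n r)) (Itilde n r t S :: 'k::field mpoly set)"
  unfolding Itilde_def
  by (rule ideal_in_gen_ideal) (use S_grid in \<open>auto simp: connected_in_def intro: fgen_in_polyring\<close>)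

lemma ideal_in_PS: "ideal_in (polyring (grid n r)) (PS n r t S :: 'k::field mpoly set)"
  unfolding PS_def using ideal_in_VarS ideal_in_Itilde by (rule ideal_in_ideal_sum)

lemma VarS_subset_PS: "(VarS n r S :: 'k::field mpoly set) \<subseteq> PS n r t S"
  using ideal_in_Itilde unfolding PS_def ideal_sum_def ideal_in_def by force

lemma Itilde_subset_PS: "(Itilde n r t S :: 'k::field mpoly set) \<subseteq> PS n r t S"
  using ideal_in_VarS unfolding PS_def ideal_sum_def ideal_in_def by force

lemma var_in_PS: "a \<in> grid n r \<Longrightarrow> a \<notin> S \<Longrightarrow> (var a :: 'k::field mpoly) \<in> PS n r t S"
  by (rule subsetD[OF VarS_subset_PS], unfold VarS_def, rule subsetD[OF gen_ideal_superset]) blast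

lemma fgen_in_PS: "i \<in> {1..t} \<Longrightarrow> connected_in n S a b \<Longrightarrow> (fgen i a b :: 'k::field mpoly) \<in> PS n r t S"
  by (rule subsetD[OF Itilde_subset_PS], unfold Itilde_def, rule subsetD[OF gen_ideal_superset]) blast

lemma PS_least:
  assumes J: "ideal_in (polyring (grid n r)) (J :: 'k::field mpoly set)"
    and "\<And>a. a \<in> grid n r \<Longrightarrow> a \<notin> S \<Longrightarrow> var a \<in> J"
    and "\<And>i a b. i \<in> {1..t} \<Longrightarrow> connected_in n S a b \<Longrightarrow> fgen i a b \<in> J"
  shows "PS n r t S \<subseteq> J"
proof -
  have "VarS n r S \<subseteq> J"
    unfolding VarS_def by (rule gen_ideal_least) (use assms in auto)
  moreover have "Itilde n r t S \<subseteq> J"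
    unfolding Itilde_def by (rule gen_ideal_least) (use assms in auto)
  ultimately show ?thesis
    using J unfolding PS_def ideal_sum_def ideal_in_def by blast
qed

text \<open>Finiteness comes from the finite grid. It is what allows the witness of an associated
  prime to be built one generator at a time.\<close>

lemma PS_finite_generators:
  obtains G :: "'k::field mpoly set" where "finite G" "G \<subseteq> PS n r t S"
    "\<And>J. ideal_in (polyring (grid n r)) J \<Longrightarrow> G \<subseteq> J \<Longrightarrow> PS n r t S \<subseteq> J"
proof -
  let ?G = "var ` (grid n r - S) \<union> {fgen i a b | i a b. i \<in> {1..t} \<and> connected_in n S a b} :: 'k mpoly set"
  have "{fgen i a b | i a b. i \<in> {1..t} \<and> connected_in n S a b} \<subseteq>
      (\<lambda>(i, a, b). fgen i a b :: 'k mpoly) ` ({1..t} \<times> grid n r \<times> grid n r)"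
  proof safe
    fix i a b assume "i \<in> {1..t}" "connected_in n S a b"
    then have "(i, a, b) \<in> {1..t} \<times> grid n r \<times> grid n r"
      using S_grid by (auto simp: connected_in_def)
    then show "(fgen i a b :: 'k mpoly) \<in> (\<lambda>(i, a, b). fgen i a b) ` ({1..t} \<times> grid n r \<times> grid n r)"
      by (rule rev_image_eqI) simp
  qed
  then have "finite {fgen i a b :: 'k mpoly | i a b. i \<in> {1..t} \<and> connected_in n S a b}"
    by (rule finite_subset) (simp add: finite_grid)
  then have "finite ?G"
    by (simp add: finite_grid)
  moreover have "?G \<subseteq> PS n r t S"
    using var_in_PS fgen_in_PS by auto
  moreover have "PS n r t S \<subseteq> J" if "ideal_in (polyring (grid n r)) J" "?G \<subseteq> J" for J
    by (rule PS_least[OF that(1)]) (use that(2) in blast)+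
  ultimately show ?thesis
    by (rule that)
qed

end

text \<open>If \<open>a\<close> and \<open>b\<close> are in \<open>S\<close> and differ at
  \<open>i\<close>, then \<open>sw i a b\<close> links them, so the generator belongs to
  \<open>Itilde\<close>. If one of them is outside \<open>S\<close>, so is one of the switched
  points, because switching these back returns \<open>a\<close> and \<open>b\<close>; then both
  monomials contain a variable outside \<open>S\<close>.\<close>

lemma Igen_subset_PS:
  assumes S: "switchable n r t S"
  shows "(Igen n r t :: 'k::field mpoly set) \<subseteq> PS n r t S"
proof -
  have sub: "S \<subseteq> grid n r"
    using S by (simp add: switchable_def)
  have P: "ideal_in (polyring (grid n r)) (PS n r t S :: 'k mpoly set)"
    using sub by (rule ideal_in_PS)
  show ?thesis
  proof (rule Igen_least[OF P])
    fix i a b assume ab: "a \<in> grid n r" "b \<in> grid n r" "dist_pt n a b = 2" "i \<in> {1..t}"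
    let ?c = "sw i a b" and ?d = "sw i b a"
    have cd: "?c \<in> grid n r" "?d \<in> grid n r"
      using ab sw_in_grid by auto
    have prod: "(var x * var y :: 'k mpoly) \<in> PS n r t S"
      if "x \<in> grid n r" "y \<in> grid n r" "\<not> (x \<in> S \<and> y \<in> S)" for x y
    proof (cases "x \<in> S")
      case True
      then show ?thesis
        using P that var_in_PS[OF sub, of y] var_in_polyring[of x] unfolding ideal_in_def by blast
    next
      case False
      then have "(var y * var x :: 'k mpoly) \<in> PS n r t S"
        using P that var_in_PS[OF sub, of x] var_in_polyring[of y] unfolding ideal_in_def by blast
      then show ?thesis
        by (simp add: mult.commute)
    qed
    show "(fgen i a b :: 'k mpoly) \<in> PS n r t S"
    proof (cases "a \<in> S \<and> b \<in> S")
      case True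
      then have cS: "?c \<in> S"
        using S ab by (auto simp: switchable_def)
      show ?thesis
      proof (cases "a i = b i")
        case True
        then have "?c = a" "?d = b"
          by (auto simp: sw_def)
        then have "(fgen i a b :: 'k mpoly) = 0"
          by (simp add: fgen_def)
        then show ?thesis
          using P by (simp add: ideal_in_def)
      next
        case False
        \<comment> \<open>After the switch only one of the two differing coordinates is left, so
          \<open>a\<close>, \<open>?c\<close>, \<open>b\<close> is a path in
          \<open>S\<close>.\<close>
        have cb: "{k\<in>{1..n}. ?c k \<noteq> b k} \<subseteq> {k\<in>{1..n}. a k \<noteq> b k} - {i}"
          by (auto simp: sw_def)
        have "i \<in> {1..n}"
          using False ab(1,2) unfolding grid_def by force
        then have "i \<in> {k\<in>{1..n}. a k \<noteq> b k}"
          using False by blast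
        then have "card ({k\<in>{1..n}. a k \<noteq> b k} - {i}) = 1"
          using ab(3) unfolding dist_pt_def by (subst card_Diff_singleton) simp_all
        then have "dist_pt n ?c b \<le> 1"
          unfolding dist_pt_def using card_mono[OF _ cb] by simp
        then have "connected_in n S ?c b"
          using cS \<open>a \<in> S \<and> b \<in> S\<close> by (intro connected_in_step) auto
        moreover have "connected_in n S a ?c"
          using connected_in_sw[OF sub _ cS] True by blast
        ultimately have "connected_in n S a b"
          using connected_in_trans by blast
        then show ?thesis
          using fgen_in_PS[OF sub ab(4)] by blast
      qed
    next
      case ab_S: False
      have "\<not> (?c \<in> S \<and> ?d \<in> S)"
      proof
        assume c: "?c \<in> S \<and> ?d \<in> S"
        have "{j\<in>{1..n}. ?c j \<noteq> ?d j} = {j\<in>{1..n}. a j \<noteq> b j}"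
          by (auto simp: sw_def)
        then have "dist_pt n ?c ?d = 2" "dist_pt n ?d ?c = 2"
          using ab(3) dist_pt_commute[of n ?c ?d] by (simp_all add: dist_pt_def)
        then have "sw i ?c ?d \<in> S" "sw i ?d ?c \<in> S"
          using S c ab(4) by (auto simp: switchable_def)
        moreover have "sw i ?c ?d = a" "sw i ?d ?c = b"
          by (auto simp: sw_def)
        ultimately show False
          using ab_S by simp
      qed
      then have "(var a * var b :: 'k mpoly) \<in> PS n r t S" "(var ?c * var ?d :: 'k mpoly) \<in> PS n r t S"
        using prod ab cd ab_S by blast+
      then show ?thesis
        unfolding fgen_def by (rule ideal_diff[OF P])
    qed
  qed
qed

lemma PS_subset_prime:
  fixes Q :: "'k::field mpoly set"
  assumes Q: "prime_in (polyring (grid n r)) Q" and IQ: "Igen n r t \<subseteq> Q"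
  defines "T \<equiv> {a \<in> grid n r. var a \<notin> Q}"
  shows "switchable n r t T" "PS n r t T \<subseteq> Q"
proof -
  have sub: "T \<subseteq> grid n r"
    by (auto simp: T_def)
  have Qi: "ideal_in (polyring (grid n r)) Q"
    using Q by (simp add: prime_in_def)
  have prime: "x \<in> Q \<or> y \<in> Q" if "x * y \<in> Q" "x \<in> polyring (grid n r)" "y \<in> polyring (grid n r)" for x y
    using Q that unfolding prime_in_def by blast
  have Tvar: "var a \<notin> Q" if "a \<in> T" for a
    using that by (simp add: T_def)
  have absorb: "x * y \<in> Q" if "x \<in> polyring (grid n r)" "y \<in> Q" for x y
    using Qi that by (simp add: ideal_in_def)
  have Rvar: "var a \<in> polyring (grid n r)" if "a \<in> grid n r" for a
    using that by (rule var_in_polyring)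
  show T: "switchable n r t T"
    unfolding switchable_def
  proof (intro conjI ballI impI sub)
    fix a b i assume ab: "a \<in> T" "b \<in> T" "dist_pt n a b = 2" "i \<in> {1..t}"
    then have g: "a \<in> grid n r" "b \<in> grid n r"
      using sub by auto
    have "fgen i a b \<in> Q"
      using fgen_in_Igen[OF g ab(3,4)] IQ by blast
    moreover have "var a * var b \<notin> Q"
      using prime[of "var a" "var b"] Tvar ab g Rvar by blast
    moreover have "(var a * var b :: 'k mpoly) = fgen i a b + var (sw i b a) * var (sw i a b)"
      by (simp add: fgen_def mult.commute)
    ultimately have "var (sw i b a) * var (sw i a b) \<notin> Q"
      using Qi unfolding ideal_in_def by metis
    then have "var (sw i a b) \<notin> Q"
      using absorb Rvar[OF sw_in_grid] g by blast
    then show "sw i a b \<in> T"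
      using g sw_in_grid by (auto simp: T_def)
  qed
  \<comment> \<open>These are the 2-minors of the matrix with rows \<open>p\<close>,
    \<open>q\<close> and columns indexed by points up to their \<open>i\<close>-th coordinate.
    Fixing \<open>p\<close> and \<open>q\<close> makes induction along a path possible, since the
    \<open>i\<close>-th coordinate may change on the way.\<close>
  have minor: "var (a(i := p)) * var (b(i := q)) - var (a(i := q)) * var (b(i := p)) \<in> Q"
    if i: "i \<in> {1..t}" and ab: "connected_in n T a b" and pq: "a(i := p) \<in> T" "a(i := q) \<in> T" for i a b p q
  proof (cases "p = q")
    case True
    then show ?thesis
      using Qi by (simp add: ideal_in_def)
  next
    case False
    have a: "a \<in> T" and path: "(\<lambda>x y. x \<in> T \<and> y \<in> T \<and> dist_pt n x y \<le> 1)\<^sup>*\<^sup>* a b"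
      using ab by (auto simp: connected_in_def)
    \<comment> \<open>Both entries of every column reached on the path stay in \<open>T\<close>, so
      their variables are outside \<open>Q\<close> and can be cancelled.\<close>
    have column: "c(i := p) \<in> T" "c(i := q) \<in> T" if "connected_in n T a c" for c
    proof -
      have "a(i := p) = sw i a (a(i := p))" "a(i := q) = sw i a (a(i := q))"
        by (auto simp: sw_def)
      then have "connected_in n T a (a(i := p))" "connected_in n T a (a(i := q))"
        using connected_in_sw[OF sub a] pq by metis+
      then have "connected_in n T c (a(i := p))" "connected_in n T c (a(i := q))"
        using that connected_in_sym connected_in_trans by blast+
      then have "sw i c (a(i := p)) \<in> T" "sw i c (a(i := q)) \<in> T"
        using switchable_connected[OF T i] by blast+
      then show "c(i := p) \<in> T" "c(i := q) \<in> T"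
        by (auto simp: sw_def)
    qed
    from path show ?thesis
    proof (induction rule: rtranclp_induct)
      case base
      then show ?case
        using Qi by (simp add: ideal_in_def mult.commute)
    next
      case (step b c)
      then have ac: "connected_in n T a b" "connected_in n T a c" and bc: "b \<in> T" "c \<in> T"
        using a by (auto simp: connected_in_def intro: rtranclp.rtrancl_into_rtrancl)
      note col = column[OF ac(1)] column[OF ac(2)]
      obtain j where j: "\<And>k. k \<noteq> j \<Longrightarrow> b k = c k"
        using step.hyps(2) dist_pt_le_1_iff[of b n r c] sub by blast
      then have eq: "b = c" if "b j = c j"
        using that by (metis ext)
      show ?case
      proof (cases "j = i \<or> b j = c j")
        case True
        then have "b(i := p) = c(i := p)" "b(i := q) = c(i := q)"
          using j eq by (auto simp: fun_eq_iff)
        then show ?thesis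
          using step.IH by simp
      next
        case neq: False
        have "dist_pt n (b(i := p)) (c(i := q)) = 2"
          by (rule dist_pt_eq_2I[where i=i and j=j and r=r])
            (use neq \<open>p \<noteq> q\<close> sub col j in auto)
        then have "fgen i (b(i := p)) (c(i := q)) \<in> Q"
          using fgen_in_Igen[of "b(i := p)" "c(i := q)" i] IQ i sub col by blast
        then have f: "var (b(i := p)) * var (c(i := q)) - var (b(i := q)) * var (c(i := p)) \<in> Q"
          by (simp add: fgen_def sw_def)
        have R: "var (a(i := p)) \<in> polyring (grid n r)" "var (c(i := p)) \<in> polyring (grid n r)"
            "var (c(i := q)) \<in> polyring (grid n r)" "var (a(i := q)) \<in> polyring (grid n r)"
            "var (b(i := p)) \<in> polyring (grid n r)"
          using sub col pq Rvar by blast+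
        let ?x = "var (b(i := p)) :: 'k mpoly"
        let ?y = "var (a(i := p)) * var (c(i := q)) - var (a(i := q)) * var (c(i := p)) :: 'k mpoly"
        \<comment> \<open>Three-column identity: writing [u,v] for the minor of columns u and v, b_p
          [a,c] = a_p [b,c] + c_p [a,b]. On the right the first minor is a distance-two generator
          and the second is the induction hypothesis.\<close>
        have "?x * ?y =
            var (a(i := p)) * (var (b(i := p)) * var (c(i := q)) - var (b(i := q)) * var (c(i := p)))
            + var (c(i := p)) * (var (a(i := p)) * var (b(i := q)) - var (a(i := q)) * var (b(i := p)))"
          by (simp add: algebra_simps)
        also have "\<dots> \<in> Q"
          using absorb[OF R(1) f] absorb[OF R(2) step.IH] Qi unfolding ideal_in_def by blast
        finally have "?x * ?y \<in> Q" .
        moreover have "?y \<in> polyring (grid n r)"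
          using R by (intro ideal_diff[OF ideal_in_carrier] mult_closed)
        moreover have "?x \<notin> Q"
          using Tvar col by blast
        ultimately show ?thesis
          using prime R(5) by blast
      qed
    qed
  qed
  show "PS n r t T \<subseteq> Q"
  proof (rule PS_least[OF sub Qi])
    show "var a \<in> Q" if "a \<in> grid n r" "a \<notin> T" for a
      using that by (simp add: T_def)
    fix i a b assume i: "i \<in> {1..t}" and ab: "connected_in n T a b"
    have "a(i := a i) \<in> T" "a(i := b i) \<in> T"
      using switchable_connected[OF T i ab] ab by (auto simp: sw_def connected_in_def)
    from minor[OF i ab this] show "fgen i a b \<in> Q"
      by (simp add: fgen_def sw_def)
  qed
qed

end

section \<open>Monomial maps\<close>

text \<open>The linear map that sends the monomial with exponent \<open>m\<close> to the one with
  exponent \<open>d m\<close> and kills every monomial involving a variable outside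
  \<open>S\<close>.\<close>

definition monomial_map ::
    "'a set \<Rightarrow> (('a \<Rightarrow>\<^sub>0 nat) \<Rightarrow> 'm) \<Rightarrow> (('a \<Rightarrow>\<^sub>0 nat) \<Rightarrow>\<^sub>0 'k::field) \<Rightarrow> ('m \<Rightarrow>\<^sub>0 'k)" where
  "monomial_map S d p = (\<Sum>m\<in>Poly_Mapping.keys p.
     if Poly_Mapping.keys m \<subseteq> S then Poly_Mapping.single (d m) (Poly_Mapping.lookup p m) else 0)"

lemma sum_singles: "(\<Sum>m\<in>Poly_Mapping.keys p. Poly_Mapping.single m (Poly_Mapping.lookup p m)) = p"
  by (rule poly_mapping_eqI) (simp add: lookup_sum lookup_single when_def in_keys_iff)

lemma monomial_map_zero [simp]: "monomial_map S d 0 = 0"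
  by (simp add: monomial_map_def)

lemma monomial_map_add: "monomial_map S d (p + q) = monomial_map S d p + monomial_map S d q"
  unfolding monomial_map_def by (rule setsum_keys_plus_distrib) (auto simp: single_add)

lemma monomial_map_diff: "monomial_map S d (p - q) = monomial_map S d p - monomial_map S d q"
  using monomial_map_add[of S d "p - q" q] by (simp add: algebra_simps)

lemma monomial_map_sum: "monomial_map S d (sum f A) = (\<Sum>a\<in>A. monomial_map S d (f a))"
  by (induction A rule: infinite_finite_induct) (simp_all add: monomial_map_add)

lemma monomial_map_single:
  "monomial_map S d (Poly_Mapping.single m c) =
    (if Poly_Mapping.keys m \<subseteq> S then Poly_Mapping.single (d m) c else 0)"
  by (simp add: monomial_map_def)

text \<open>By bilinearity it is enough to treat single terms. There \<open>d\<close> is additive,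
  and a product involves only variables of \<open>S\<close> exactly when both factors do.\<close>

lemma monomial_map_mult:
  fixes d :: "('a \<Rightarrow>\<^sub>0 nat) \<Rightarrow> 'm::comm_monoid_add" and p q :: "('a \<Rightarrow>\<^sub>0 nat) \<Rightarrow>\<^sub>0 'k::field"
  assumes d: "\<And>m m'. d (m + m') = d m + d m'"
  shows "monomial_map S d (p * q) = monomial_map S d p * monomial_map S d q"
proof -
  let ?f = "monomial_map S d :: _ \<Rightarrow> ('m \<Rightarrow>\<^sub>0 'k)"
  let ?p = "\<lambda>m. Poly_Mapping.single m (Poly_Mapping.lookup p m)"
  let ?q = "\<lambda>m. Poly_Mapping.single m (Poly_Mapping.lookup q m)"
  have "?f (p * q) = ?f (sum ?p (Poly_Mapping.keys p) * sum ?q (Poly_Mapping.keys q))"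
    by (simp only: sum_singles)
  also have "\<dots> = (\<Sum>m\<in>Poly_Mapping.keys p. \<Sum>m'\<in>Poly_Mapping.keys q. ?f (?p m * ?q m'))"
    by (simp only: sum_product monomial_map_sum)
  also have "\<dots> = (\<Sum>m\<in>Poly_Mapping.keys p. \<Sum>m'\<in>Poly_Mapping.keys q. ?f (?p m) * ?f (?q m'))"
    by (intro sum.cong refl) (auto simp: monomial_map_single mult_single keys_plus_nat d)
  also have "\<dots> = ?f (sum ?p (Poly_Mapping.keys p)) * ?f (sum ?q (Poly_Mapping.keys q))"
    by (simp only: sum_product monomial_map_sum)
  also have "\<dots> = ?f p * ?f q"
    by (simp only: sum_singles)
  finally show ?thesis .
qed

section \<open>The toric parametrization of \<open>P\<^sub>S\<close>\<close>

lemma single_split: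
  fixes m :: "'a \<Rightarrow>\<^sub>0 nat"
  assumes "a \<in> Poly_Mapping.keys m"
  obtains m' where "m = Poly_Mapping.single a 1 + m'"
proof
  show "m = Poly_Mapping.single a 1 + (m - Poly_Mapping.single a 1)"
    using assms
    by (intro poly_mapping_eqI) (auto simp: lookup_add minus_poly_mapping.rep_eq lookup_single when_def in_keys_iff)
qed

text \<open>The blocks with \<open>l \<le> t\<close> partition all indices. Index 0 is free to
  denote the tail block because coordinates start at 1.\<close>

definition block :: "nat \<Rightarrow> nat \<Rightarrow> nat set" where
  "block t l = (if l = 0 then - {1..t} else {l})"

text \<open>The variable \<open>y l a\<close> records the component of \<open>a\<close> and its coordinate \<open>a\<^sub>l\<close> if \<open>1 \<le> l \<le> t\<close>, and
  the component and all coordinates beyond \<open>t\<close> if \<open>l = 0\<close>. Variables are natural numbers, since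
  polynomials form an integral domain only over a linearly ordered type of variables.\<close>

locale toric_parametrization =
  fixes n t :: nat and r :: "nat \<Rightarrow> nat" and S :: "point set" and y :: "nat \<Rightarrow> point \<Rightarrow> nat"
  assumes switchable: "switchable n r t S"
    and y_eq_iff: "\<And>l l' a b. l \<le> t \<Longrightarrow> l' \<le> t \<Longrightarrow> a \<in> S \<Longrightarrow> b \<in> S \<Longrightarrow>
      y l a = y l' b \<longleftrightarrow> l = l' \<and> connected_in n S a b \<and> (\<forall>k\<in>block t l. a k = b k)"
begin

text \<open>The exponent of the image of a monomial when each x_a with \<open>a\<close> in
  \<open>S\<close> is replaced by the product of \<open>y l a\<close> over
  \<open>l \<le> t\<close>.\<close>

definition deg :: "(point \<Rightarrow>\<^sub>0 nat) \<Rightarrow> (nat \<Rightarrow>\<^sub>0 nat)" where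
  "deg m = (\<Sum>a\<in>S. \<Sum>l\<le>t. Poly_Mapping.single (y l a) (Poly_Mapping.lookup m a))"

lemma S_grid: "S \<subseteq> grid n r"
  using switchable by (simp add: switchable_def)

lemma finite_S: "finite S"
  using S_grid finite_grid by (rule finite_subset)

lemma deg_add: "deg (m + m') = deg m + deg m'"
  by (simp add: deg_def lookup_add single_add sum.distrib)

lemma deg_single:
  assumes "a \<in> S"
  shows "deg (Poly_Mapping.single a 1) = (\<Sum>l\<le>t. Poly_Mapping.single (y l a) 1)"
proof -
  have "deg (Poly_Mapping.single a 1) = (\<Sum>b\<in>S. if a = b then \<Sum>l\<le>t. Poly_Mapping.single (y l a) 1 else 0)"
    unfolding deg_def by (intro sum.cong) (auto simp: lookup_single when_def)
  then show ?thesis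
    using assms finite_S by simp
qed

lemma keys_deg_iff: "v \<in> Poly_Mapping.keys (deg m) \<longleftrightarrow> (\<exists>a\<in>S. \<exists>l\<le>t. y l a = v \<and> a \<in> Poly_Mapping.keys m)"
proof -
  have "Poly_Mapping.lookup (deg m) v = (\<Sum>a\<in>S. \<Sum>l\<le>t. Poly_Mapping.lookup m a when y l a = v)"
    by (simp add: deg_def lookup_sum lookup_single)
  then show ?thesis
    using finite_S by (auto simp: in_keys_iff when_def)
qed

text \<open>The variable \<open>y l a\<close> divides the common image, so some point of
  \<open>m\<close> must contribute it; \<open>y_eq_iff\<close> then forces the same block and the
  same component.\<close>

lemma deg_eq_matching:
  assumes "deg m = deg m'" "Poly_Mapping.keys m' \<subseteq> S" "a \<in> Poly_Mapping.keys m'" "l \<le> t"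
  obtains b where "b \<in> Poly_Mapping.keys m" "connected_in n S b a" "\<forall>k\<in>block t l. b k = a k"
proof -
  have "y l a \<in> Poly_Mapping.keys (deg m)"
    using assms keys_deg_iff by auto
  then obtain b l' where "b \<in> S" "l' \<le> t" "y l' b = y l a" "b \<in> Poly_Mapping.keys m"
    using keys_deg_iff by blast
  then show ?thesis
    using that y_eq_iff[of l' l b a] assms by blast
qed

text \<open>All four points lie in one component, so the switch swaps the two variables of block
  \<open>i\<close> and preserves those of every other block.\<close>

lemma deg_sw:
  assumes i: "i \<in> {1..t}" and bc: "connected_in n S b c"
  shows "deg (Poly_Mapping.single b 1 + Poly_Mapping.single c 1) =
    deg (Poly_Mapping.single (sw i b c) 1 + Poly_Mapping.single (sw i c b) 1)"
proof -
  note cb = connected_in_sym[OF bc]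
  let ?b = "sw i b c" and ?c = "sw i c b"
  have conn: "connected_in n S ?b b" "connected_in n S ?c c" "connected_in n S ?b c" "connected_in n S ?c b"
    using switchable_connected_sw[OF switchable i] bc cb connected_in_sym connected_in_trans by blast+
  have mem: "b \<in> S" "c \<in> S" "?b \<in> S" "?c \<in> S"
    using conn by (auto simp: connected_in_def)
  have "Poly_Mapping.single (y l b) 1 + Poly_Mapping.single (y l c) 1 =
      Poly_Mapping.single (y l ?b) (1 :: nat) + Poly_Mapping.single (y l ?c) 1" if l: "l \<le> t" for l
  proof (cases "l = i")
    case True
    then have "y l ?b = y l c" "y l ?c = y l b"
      using y_eq_iff[OF l l] mem conn i by (auto simp: block_def sw_def)
    then show ?thesis
      by (simp add: add.commute)
  next
    case False
    then have "y l ?b = y l b" "y l ?c = y l c"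
      using y_eq_iff[OF l l] mem conn i by (auto simp: block_def sw_def)
    then show ?thesis
      by simp
  qed
  then have "(\<Sum>l\<le>t. Poly_Mapping.single (y l b) 1 + Poly_Mapping.single (y l c) 1) =
      (\<Sum>l\<le>t. Poly_Mapping.single (y l ?b) (1 :: nat) + Poly_Mapping.single (y l ?c) 1)"
    by (intro sum.cong) simp_all
  then show ?thesis
    using mem by (simp only: deg_add deg_single sum.distrib)
qed

abbreviation monom :: "(point \<Rightarrow>\<^sub>0 nat) \<Rightarrow> 'k::field mpoly" where
  "monom m \<equiv> Poly_Mapping.single m 1"

section \<open>Monomials modulo the switch relations\<close>

context
  fixes J :: "'k::field mpoly set"
  assumes J: "ideal_in (polyring (grid n r)) J"
    and fgen_J: "\<And>i a b. i \<in> {1..t} \<Longrightarrow> connected_in n S a b \<Longrightarrow> fgen i a b \<in> J"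
begin

interpretation subring_carrier "polyring (grid n r) :: 'k mpoly set"
  by (rule subring_carrier_polyring)

lemma monom_cong_trans:
  assumes "monom m - monom m' \<in> J" "monom m' - monom m'' \<in> J"
  shows "monom m - monom m'' \<in> J"
proof -
  have "(monom m - monom m') + (monom m' - monom m'') \<in> J"
    using J assms unfolding ideal_in_def by blast
  then show ?thesis
    by simp
qed

lemma monom_cong_add:
  assumes "Poly_Mapping.keys c \<subseteq> S" "monom m - monom m' \<in> J"
  shows "monom (m + c) - monom (m' + c) \<in> J"
proof -
  have "monom c \<in> polyring (grid n r)"
    using assms(1) S_grid by (intro single_in_polyring) blast
  then have "monom c * (monom m - monom m') \<in> J"
    using assms(2) J unfolding ideal_in_def by blast
  then show ?thesis
    by (simp add: right_diff_distrib mult_single add.commute)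
qed

text \<open>Switches create the prescribed point \<open>a\<close> inside \<open>m\<close>. Start
  from a point \<open>b\<close> of the component with the tail of \<open>a\<close>, then correct
  coordinates 1 to \<open>t\<close> in turn: equality of degrees supplies a point \<open>c\<close>
  of the current monomial with the right next coordinate, and \<open>b\<close> takes it from
  \<open>c\<close>.\<close>

lemma straighten:
  assumes m: "Poly_Mapping.keys m \<subseteq> S" and m': "Poly_Mapping.keys m' \<subseteq> S"
    and eq: "deg m = deg m'" and a: "a \<in> Poly_Mapping.keys m'"
  obtains m1 where "Poly_Mapping.keys m1 \<subseteq> S" "deg m1 = deg m'" "a \<in> Poly_Mapping.keys m1"
    "monom m - monom m1 \<in> J"
proof -
  have "j \<le> t \<Longrightarrow> \<exists>m1 b. Poly_Mapping.keys m1 \<subseteq> S \<and> deg m1 = deg m' \<and> b \<in> Poly_Mapping.keys m1 \<and>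
      connected_in n S b a \<and> (\<forall>k. k \<notin> {1..t} \<or> k \<le> j \<longrightarrow> b k = a k) \<and> monom m - monom m1 \<in> J" for j
  proof (induction j)
    case 0
    obtain b where b: "b \<in> Poly_Mapping.keys m" "connected_in n S b a" "\<forall>k\<in>block t 0. b k = a k"
      using deg_eq_matching[OF eq m' a, of 0] by blast
    moreover have "monom m - monom m \<in> J"
      using J by (simp add: ideal_in_def)
    ultimately show ?case
      using m eq by (intro exI[of _ m] exI[of _ b]) (auto simp: block_def)
  next
    case (Suc j)
    then obtain m1 b where IH: "Poly_Mapping.keys m1 \<subseteq> S" "deg m1 = deg m'" "b \<in> Poly_Mapping.keys m1"
        "connected_in n S b a" "\<And>k. k \<notin> {1..t} \<or> k \<le> j \<Longrightarrow> b k = a k" "monom m - monom m1 \<in> J"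
      using Suc_leD by blast
    let ?i = "Suc j"
    have i: "?i \<in> {1..t}"
      using Suc.prems by simp
    obtain c where c: "c \<in> Poly_Mapping.keys m1" "connected_in n S c a" "c ?i = a ?i"
      using deg_eq_matching[OF IH(2) m' a Suc.prems] by (auto simp: block_def)
    show ?case
    proof (cases "b ?i = a ?i")
      case True
      then have "b k = a k" if "k \<notin> {1..t} \<or> k \<le> Suc j" for k
        using that IH(5)[of k] le_SucE[of k j] by blast
      then show ?thesis
        using IH(1-4,6) by (intro exI[of _ m1] exI[of _ b] conjI allI impI)
    next
      case False
      \<comment> \<open>Distinctness ensures that the product of both variables divides
        \<open>m1\<close>, even if each occurs only once.\<close>
      then have "b \<noteq> c"
        using c by auto
      obtain m2 where m2: "m1 = Poly_Mapping.single b 1 + m2"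
        using single_split[OF IH(3)] .
      then have c_m2: "c \<in> Poly_Mapping.keys m2"
        using c(1) \<open>b \<noteq> c\<close> by (auto simp: keys_plus_nat)
      obtain m3 where m3: "m2 = Poly_Mapping.single c 1 + m3"
        using single_split[OF c_m2] .
      let ?b = "sw ?i b c" and ?c = "sw ?i c b"
      let ?bc = "Poly_Mapping.single b 1 + Poly_Mapping.single c 1 :: point \<Rightarrow>\<^sub>0 nat"
      let ?bc' = "Poly_Mapping.single ?b 1 + Poly_Mapping.single ?c 1 :: point \<Rightarrow>\<^sub>0 nat"
      have m1: "m1 = ?bc + m3"
        using m2 m3 by (simp add: add.assoc)
      have bc: "connected_in n S b c" "connected_in n S c b"
        using IH(4) c(2) connected_in_sym connected_in_trans by blast+
      have conn: "connected_in n S b ?b" "connected_in n S c ?c"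
        using switchable_connected_sw[OF switchable i] bc by blast+
      have "(monom ?bc :: 'k mpoly) - monom ?bc' = fgen ?i b c"
        by (simp add: fgen_def var_def mult_single)
      then have "(monom ?bc :: 'k mpoly) - monom ?bc' \<in> J"
        using fgen_J[OF i bc(1)] by simp
      moreover have keys_m3: "Poly_Mapping.keys m3 \<subseteq> S"
        using IH(1) m1 by (simp add: keys_plus_nat)
      ultimately have "(monom m1 :: 'k mpoly) - monom (?bc' + m3) \<in> J"
        using monom_cong_add m1 by blast
      then have "(monom m :: 'k mpoly) - monom (?bc' + m3) \<in> J"
        using monom_cong_trans IH(6) by blast
      moreover have "deg (?bc' + m3) = deg m'"
        using IH(2) deg_sw[OF i bc(1)] unfolding m1 deg_add by simp
      moreover have "Poly_Mapping.keys (?bc' + m3) \<subseteq> S" "?b \<in> Poly_Mapping.keys (?bc' + m3)"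
        using conn keys_m3 by (auto simp: keys_plus_nat connected_in_def)
      moreover have "connected_in n S ?b a"
        using conn(1) IH(4) connected_in_sym connected_in_trans by blast
      moreover have "?b k = a k" if k: "k \<notin> {1..t} \<or> k \<le> Suc j" for k
      proof (cases "k = Suc j")
        case True
        then show ?thesis
          using c(3) by (simp add: sw_def)
      next
        case False
        then have "b k = a k"
          using k IH(5)[of k] le_SucE[of k j] by blast
        then show ?thesis
          using False by (simp add: sw_def)
      qed
      ultimately show ?thesis
        by (intro exI[of _ "?bc' + m3"] exI[of _ ?b] conjI allI impI)
    qed
  qed
  from this[of t] obtain m1 b where m1: "Poly_Mapping.keys m1 \<subseteq> S" "deg m1 = deg m'" "b \<in> Poly_Mapping.keys m1"
      "\<And>k. k \<notin> {1..t} \<or> k \<le> t \<Longrightarrow> b k = a k" "monom m - monom m1 \<in> J"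
    using order_refl by blast
  have "b k = a k" for k
    using m1(4)[of k] by (cases "k \<le> t") simp_all
  then have "b = a"
    by blast
  then show ?thesis
    using that m1 by blast
qed

text \<open>Induction on the total degree of \<open>m'\<close>: after straightening, both monomials
  contain a common variable, which is split off.\<close>

lemma monom_cong_if_deg_eq:
  assumes "Poly_Mapping.keys m \<subseteq> S" "Poly_Mapping.keys m' \<subseteq> S" "deg m = deg m'"
  shows "monom m - monom m' \<in> J"
  using assms
proof (induction "sum (Poly_Mapping.lookup m') S" arbitrary: m m' rule: less_induct)
  case less
  show ?case
  proof (cases "m' = 0")
    case True
    then have "deg m = 0"
      using less.prems(3) by (simp add: deg_def)
    \<comment> \<open>Each point of \<open>m\<close> would contribute its tail variable to
      \<open>deg m\<close>, so degree zero leaves only the constant monomial.\<close>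
    then have "y 0 b \<notin> Poly_Mapping.keys (deg m)" for b
      by simp
    then have "b \<notin> Poly_Mapping.keys m" for b
      using keys_deg_iff[of "y 0 b" m] less.prems(1) by blast
    then have "m = 0"
      using keys_eq_empty by blast
    then show ?thesis
      using True J by (simp add: ideal_in_def)
  next
    case False
    then obtain a where a: "a \<in> Poly_Mapping.keys m'"
      using keys_eq_empty by blast
    then have aS: "a \<in> S"
      using less.prems by blast
    obtain m1 where m1: "Poly_Mapping.keys m1 \<subseteq> S" "deg m1 = deg m'" "a \<in> Poly_Mapping.keys m1"
        "monom m - monom m1 \<in> J"
      using straighten[OF less.prems a] .
    obtain p where p: "m1 = Poly_Mapping.single a 1 + p"
      using single_split[OF m1(3)] .
    obtain q where q: "m' = Poly_Mapping.single a 1 + q"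
      using single_split[OF a] .
    have "deg p = deg q"
      using m1(2) unfolding p q deg_add by simp
    moreover have "Poly_Mapping.keys p \<subseteq> S" "Poly_Mapping.keys q \<subseteq> S"
      using m1(1) less.prems(2) p q by (auto simp: keys_plus_nat)
    moreover have "sum (Poly_Mapping.lookup q) S < sum (Poly_Mapping.lookup m') S"
      unfolding q using finite_S aS by (simp add: lookup_add sum.distrib lookup_single when_def)
    ultimately have "(monom p :: 'k mpoly) - monom q \<in> J"
      using less.hyps by blast
    then have "(monom (p + Poly_Mapping.single a 1) :: 'k mpoly) - monom (q + Poly_Mapping.single a 1) \<in> J"
      using aS by (intro monom_cong_add) auto
    then have "(monom m1 :: 'k mpoly) - monom m' \<in> J"
      by (simp add: p q add.commute)
    then show ?thesis
      using monom_cong_trans m1(4) by blast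
  qed
qed

text \<open>Modulo \<open>J\<close>, terms with a variable outside \<open>S\<close> vanish and every
  other monomial may be replaced by a representative of its degree. The coefficients then add up
  over each fibre of \<open>deg\<close> to a coefficient of the image, which is zero.\<close>

lemma monomial_map_kernel_subset:
  assumes var_J: "\<And>a. a \<in> grid n r \<Longrightarrow> a \<notin> S \<Longrightarrow> var a \<in> J"
    and p: "p \<in> polyring (grid n r)" and ker: "monomial_map S deg p = 0"
  shows "p \<in> J"
proof -
  let ?c = "Poly_Mapping.lookup p"
  define A where "A = {m \<in> Poly_Mapping.keys p. Poly_Mapping.keys m \<subseteq> S}"
  have finA: "finite A"
    by (simp add: A_def)
  have keys_grid: "Poly_Mapping.keys m \<subseteq> grid n r" if "m \<in> Poly_Mapping.keys p" for m
    using p that by (auto simp: polyring_def)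
  have const: "Poly_Mapping.single 0 c \<in> polyring (grid n r)" for c :: 'k
    by (rule single_in_polyring) simp
  have outside: "Poly_Mapping.single m (?c m) \<in> J" if m: "m \<in> Poly_Mapping.keys p - A" for m
  proof -
    obtain a where a: "a \<in> Poly_Mapping.keys m" "a \<notin> S"
      using m by (auto simp: A_def)
    obtain m' where m': "m = Poly_Mapping.single a 1 + m'"
      using single_split[OF a(1)] .
    have "Poly_Mapping.single m' (?c m) \<in> polyring (grid n r)"
      using keys_grid[of m] m m' by (intro single_in_polyring) (auto simp: keys_plus_nat)
    moreover have "var a \<in> J"
      using var_J a keys_grid[of m] m by blast
    ultimately have "Poly_Mapping.single m' (?c m) * var a \<in> J"
      using J unfolding ideal_in_def by blast
    then show ?thesis
      unfolding var_def m' mult_single by (simp add: add.commute)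
  qed
  define rep where "rep w = (SOME m. m \<in> A \<and> deg m = w)" for w
  have rep: "rep (deg m) \<in> A" "deg (rep (deg m)) = deg m" if "m \<in> A" for m
    using that someI[of "\<lambda>m'. m' \<in> A \<and> deg m' = deg m" m] unfolding rep_def by auto
  have inside: "Poly_Mapping.single m (?c m) - Poly_Mapping.single (rep (deg m)) (?c m) \<in> J" if m: "m \<in> A" for m
  proof -
    have "(monom m :: 'k mpoly) - monom (rep (deg m)) \<in> J"
      using m rep[OF m] by (intro monom_cong_if_deg_eq) (auto simp: A_def)
    then have "Poly_Mapping.single 0 (?c m) * (monom m - monom (rep (deg m))) \<in> J"
      using J const unfolding ideal_in_def by blast
    then show ?thesis
      by (simp add: right_diff_distrib mult_single)
  qed
  have image: "(\<Sum>m\<in>A. Poly_Mapping.single (deg m) (?c m)) = 0"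
    using ker unfolding monomial_map_def A_def by (subst sum.inter_filter) simp_all
  \<comment> \<open>This sum is the coefficient of the image at the exponent
    \<open>w\<close>.\<close>
  have fibre: "(\<Sum>m\<in>{m \<in> A. deg m = w}. ?c m) = 0" for w
  proof -
    have "Poly_Mapping.lookup (\<Sum>m\<in>A. Poly_Mapping.single (deg m) (?c m)) w = 0"
      using image by simp
    then show ?thesis
      by (subst sum.inter_filter[OF finA]) (simp add: lookup_sum lookup_single when_def)
  qed
  have "(\<Sum>m\<in>A. Poly_Mapping.single (rep (deg m)) (?c m)) =
      (\<Sum>w\<in>deg ` A. \<Sum>m\<in>{m \<in> A. deg m = w}. Poly_Mapping.single (rep (deg m)) (?c m))"
    by (rule sum.image_gen[OF finA])
  also have "\<dots> = (\<Sum>w\<in>deg ` A. Poly_Mapping.single (rep w) (\<Sum>m\<in>{m \<in> A. deg m = w}. ?c m))"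
  proof (rule sum.cong[OF refl])
    fix w
    have "Poly_Mapping.single (rep w) (sum ?c B) = (\<Sum>m\<in>B. Poly_Mapping.single (rep w) (?c m))" for B
      by (induction B rule: infinite_finite_induct) (simp_all add: single_add)
    then show "(\<Sum>m\<in>{m \<in> A. deg m = w}. Poly_Mapping.single (rep (deg m)) (?c m)) =
        Poly_Mapping.single (rep w) (\<Sum>m\<in>{m \<in> A. deg m = w}. ?c m)"
      by simp
  qed
  finally have reps: "(\<Sum>m\<in>A. Poly_Mapping.single (rep (deg m)) (?c m)) = 0"
    by (simp add: fibre)
  have "p = (\<Sum>m\<in>Poly_Mapping.keys p. Poly_Mapping.single m (?c m))"
    by (simp only: sum_singles)
  also have "\<dots> = (\<Sum>m\<in>Poly_Mapping.keys p - A. Poly_Mapping.single m (?c m)) + (\<Sum>m\<in>A. Poly_Mapping.single m (?c m))"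
    by (rule sum.subset_diff) (auto simp: A_def)
  also have "(\<Sum>m\<in>A. Poly_Mapping.single m (?c m)) =
      (\<Sum>m\<in>A. Poly_Mapping.single m (?c m) - Poly_Mapping.single (rep (deg m)) (?c m))"
    by (simp add: sum_subtractf reps)
  also have "(\<Sum>m\<in>Poly_Mapping.keys p - A. Poly_Mapping.single m (?c m)) + \<dots> \<in> J"
    using J outside inside by (intro ideal_add ideal_sum_elements)
  finally show ?thesis .
qed

end

section \<open>Kernel description and primality\<close>

lemma monomial_map_var:
  "monomial_map S deg (var a :: 'k::field mpoly) =
    (if a \<in> S then Poly_Mapping.single (deg (Poly_Mapping.single a 1)) 1 else 0)"
  by (simp add: var_def monomial_map_single)

text \<open>One inclusion is checked on generators, where \<open>deg_sw\<close> makes the two terms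
  of \<open>fgen\<close> cancel; the other is \<open>monomial_map_kernel_subset\<close> with
  \<open>PS\<close> itself as \<open>J\<close>.\<close>

lemma PS_eq_kernel:
  "(PS n r t S :: 'k::field mpoly set) = {p \<in> polyring (grid n r). monomial_map S deg p = 0}"
proof
  interpret subring_carrier "polyring (grid n r) :: 'k mpoly set"
    by (rule subring_carrier_polyring)
  note mult = monomial_map_mult[of deg, OF deg_add]
  let ?K = "{p \<in> polyring (grid n r). monomial_map S deg p = 0} :: 'k mpoly set"
  have K: "ideal_in (polyring (grid n r)) ?K"
    using zero_closed add_closed mult_closed by (auto simp: ideal_in_def monomial_map_add mult)
  show "PS n r t S \<subseteq> ?K"
  proof (rule PS_least[OF S_grid K])
    show "var a \<in> ?K" if "a \<in> grid n r" "a \<notin> S" for a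
      using that by (simp add: var_in_polyring monomial_map_var)
    fix i a b assume i: "i \<in> {1..t}" and ab: "connected_in n S a b"
    have ba: "connected_in n S b a"
      using ab by (rule connected_in_sym)
    have mem: "a \<in> S" "b \<in> S" "sw i a b \<in> S" "sw i b a \<in> S"
      using ab switchable_connected[OF switchable i ab] switchable_connected[OF switchable i ba]
      by (auto simp: connected_in_def)
    have "monomial_map S deg (fgen i a b :: 'k mpoly) = 0"
      using mem deg_sw[OF i ab] by (simp add: fgen_def monomial_map_diff mult monomial_map_var mult_single deg_add)
    then show "fgen i a b \<in> ?K"
      using fgen_in_polyring mem S_grid by blast
  qed
  show "?K \<subseteq> PS n r t S"
  proof safe
    fix p :: "'k mpoly"
    assume p: "p \<in> polyring (grid n r)" "monomial_map S deg p = 0"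
    show "p \<in> PS n r t S"
      by (rule monomial_map_kernel_subset[OF ideal_in_PS[OF S_grid] _ _ p])
        (simp_all add: fgen_in_PS[OF S_grid] var_in_PS[OF S_grid])
  qed
qed

text \<open>A kernel of a multiplicative map into an integral domain, the polynomials in variables
  indexed by naturals; it is proper because 1 has nonzero image.\<close>

lemma PS_prime: "prime_in (polyring (grid n r)) (PS n r t S :: 'k::field mpoly set)"
  unfolding prime_in_def
proof (intro conjI ballI impI)
  interpret subring_carrier "polyring (grid n r) :: 'k mpoly set"
    by (rule subring_carrier_polyring)
  show "ideal_in (polyring (grid n r)) (PS n r t S :: 'k mpoly set)"
    using S_grid by (rule ideal_in_PS)
  have "monomial_map S deg (Poly_Mapping.single 0 1 :: 'k mpoly) \<noteq> 0"
    by (simp only: monomial_map_single) (simp flip: keys_eq_empty)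
  then have "(1 :: 'k mpoly) \<notin> PS n r t S"
    by (simp add: PS_eq_kernel)
  then show "(PS n r t S :: 'k mpoly set) \<noteq> polyring (grid n r)"
    using one_closed by blast
  fix p q :: "'k mpoly"
  assume "p \<in> polyring (grid n r)" "q \<in> polyring (grid n r)" "p * q \<in> PS n r t S"
  then show "p \<in> PS n r t S \<or> q \<in> PS n r t S"
    by (simp add: PS_eq_kernel monomial_map_mult[of deg, OF deg_add])
qed

lemma var_notin_PS: "a \<in> S \<Longrightarrow> (var a :: 'k::field mpoly) \<notin> PS n r t S"
  by (simp add: PS_eq_kernel monomial_map_var flip: keys_eq_empty)

end

text \<open>The variables are equivalence classes of pairs of a block and a point, numbered
  injectively, which is possible as there are finitely many.\<close>

lemma toric_parametrization_exists:
  assumes S: "switchable n r t S"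
  obtains y where "toric_parametrization n t r S y"
proof -
  \<comment> \<open>The tag \<open>l'\<close> keeps classes of different blocks apart.\<close>
  define cl where "cl l a = {(l', b). l' = l \<and> connected_in n S a b \<and> (\<forall>k\<in>block t l. a k = b k)}" for l a
  let ?W = "(\<lambda>(l, a). cl l a) ` ({..t} \<times> S)"
  have "finite S"
    using S finite_grid finite_subset unfolding switchable_def by blast
  then have "finite ?W"
    by simp
  then obtain e :: "(nat \<times> point) set \<Rightarrow> nat" where e: "inj_on e ?W"
    using finite_imp_inj_to_nat_seg by metis
  have "toric_parametrization n t r S (\<lambda>l a. e (cl l a))"
  proof
    fix l l' a b assume *: "l \<le> t" "l' \<le> t" "a \<in> S" "b \<in> S"
    then have "cl l a \<in> ?W" "cl l' b \<in> ?W"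
      by force+
    then have "e (cl l a) = e (cl l' b) \<longleftrightarrow> cl l a = cl l' b"
      by (rule inj_on_eq_iff[OF e])
    also have "\<dots> \<longleftrightarrow> l = l' \<and> connected_in n S a b \<and> (\<forall>k\<in>block t l. a k = b k)"
    proof
      assume eq: "cl l a = cl l' b"
      have "(l', b) \<in> cl l' b"
        using * connected_in_refl by (auto simp: cl_def)
      then have "(l', b) \<in> cl l a"
        using eq by simp
      then show "l = l' \<and> connected_in n S a b \<and> (\<forall>k\<in>block t l. a k = b k)"
        by (simp add: cl_def)
    next
      assume h: "l = l' \<and> connected_in n S a b \<and> (\<forall>k\<in>block t l. a k = b k)"
      then have "connected_in n S a c \<longleftrightarrow> connected_in n S b c" for c
        using connected_in_sym connected_in_trans by blast
      then show "cl l a = cl l' b"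
        using h by (auto simp: cl_def)
    qed
    finally show "e (cl l a) = e (cl l' b) \<longleftrightarrow> l = l' \<and> connected_in n S a b \<and> (\<forall>k\<in>block t l. a k = b k)" .
  qed (rule S)
  then show ?thesis
    by (rule that)
qed

theorem theorem4p12:
  fixes n t :: nat and r :: "nat \<Rightarrow> nat" and S :: "point set"
  assumes "n \<ge> 1" and "\<forall>j\<in>{1..n}. r j \<ge> 1"
    and "t \<in> {1..n}"
    and "max_switchable TYPE('k::field) n r t S"
  shows "min_assoc_prime (polyring (grid n r)) (Igen n r t) (PS n r t S :: 'k mpoly set)"
proof -
  interpret subring_carrier "polyring (grid n r) :: 'k mpoly set"
    by (rule subring_carrier_polyring)
  have S: "switchable n r t S"
    and max: "\<And>T. switchable n r t T \<Longrightarrow> S \<subset> T \<Longrightarrow> \<not> (PS n r t T :: 'k mpoly set) \<subseteq> PS n r t S"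
    using assms(4) by (auto simp: max_switchable_def)
  then have S_grid: "S \<subseteq> grid n r"
    by (simp add: switchable_def)
  obtain y where "toric_parametrization n t r S y"
    using toric_parametrization_exists[OF S] .
  then interpret toric_parametrization n t r S y .
  obtain G :: "'k mpoly set" where G: "finite G" "G \<subseteq> PS n r t S"
      "\<And>J. ideal_in (polyring (grid n r)) J \<Longrightarrow> G \<subseteq> J \<Longrightarrow> PS n r t S \<subseteq> J"
    using PS_finite_generators[OF S_grid] by blast
  show ?thesis
  proof (rule min_assoc_prime_of_minimal_prime[OF ideal_in_Igen PS_prime Igen_subset_PS[OF S] G])
    fix Q :: "'k mpoly set"
    assume Q: "prime_in (polyring (grid n r)) Q" "Igen n r t \<subseteq> Q" "Q \<subseteq> PS n r t S"
    let ?T = "{a \<in> grid n r. var a \<notin> Q}"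
    have T: "switchable n r t ?T" "PS n r t ?T \<subseteq> Q"
      using PS_subset_prime[OF Q(1,2)] by auto
    have "S \<subseteq> ?T"
      using Q(3) S_grid var_notin_PS by blast
    \<comment> \<open>A strictly larger \<open>?T\<close> would have its ideal inside
      \<open>Q\<close>, hence inside that of \<open>S\<close>, which maximality forbids.\<close>
    moreover have "\<not> S \<subset> ?T"
      using max[OF T(1)] T(2) Q(3) by blast
    ultimately have "S = ?T"
      by blast
    then show "Q = PS n r t S"
      using T(2) Q(3) by simp
  qed
qed

end
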